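(* Let $\mathcal U$ be the complexification of a real Hilbert space $H$, and let $f:\mathcal U\to\mathbb R$ be a continuous function that is analytic in $\mathbf z$ and in $\overline{\mathbf z}$, separately (in the sense given in the context). Then for all $\mathbf z_0,\delta\mathbf z\in\mathcal U$ the limit $$\mathrm d^{\mathbb R}f(\mathbf z_0;\delta\mathbf z):=\lim_{t\to0,\ t\in\mathbb R}\frac{f(\mathbf z_0+t\,\delta\mathbf z)-f(\mathbf z_0)}{t}$$ exists, and moreover $$\mathrm d^{\mathbb R}f(\mathbf z_0;\delta\mathbf z)=2\,\mathrm{Re}\left(\frac{\partial f}{\partial\overline{\mathbf z}}(\mathbf z_0),\delta\mathbf z\right)_{\mathcal U}\qquad\forall\,\mathbf z_0,\delta\mathbf z\in\mathcal U.$$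
   Context: $\mathcal U=H+\mathrm iH$, with conjugation $\overline{\mathbf x+\mathrm i\mathbf y}=\mathbf x-\mathrm i\mathbf y$ and inner product (linear in the first, conjugate linear in the second argument) $$(\mathbf u_1+\mathrm i\mathbf v_1,\mathbf u_2+\mathrm i\mathbf v_2)_{\mathcal U}=(\mathbf u_1,\mathbf u_2)_H+(\mathbf v_1,\mathbf v_2)_H+\mathrm i\big((\mathbf v_1,\mathbf u_2)_H-(\mathbf u_1,\mathbf v_2)_H\big).$$ "Analytic in $\mathbf z$ and in $\overline{\mathbf z}$, separately" means: there is a continuous, complex Fréchet differentiable function $g:\mathcal U\times\mathcal U\to\mathbb C$ with $g(\mathbf z,\overline{\mathbf z})=f(\mathbf z)$ for all $\mathbf z\in\mathcal U$. The Wirtinger derivatives $\frac{\partial f}{\partial\mathbf z}(\mathbf z_0),\frac{\partial f}{\partial\overline{\mathbf z}}(\mathbf z_0)\in\mathcal U$ are the first and second components of the gradient of $g$ at $(\mathbf z_0,\overline{\mathbf z_0})$, i.e. the elements of $\mathcal U$ such that for all $\mathbf a,\mathbf b\in\mathcal U$ the (complex linear) Fréchet derivative satisfies $$Dg(\mathbf z_0,\overline{\mathbf z_0})[(\mathbf a,\mathbf b)]=\left(\mathbf a,\overline{\tfrac{\partial f}{\partial\mathbf z}(\mathbf z_0)}\right)_{\mathcal U}+\left(\mathbf b,\overline{\tfrac{\partial f}{\partial\overline{\mathbf z}}(\mathbf z_0)}\right)_{\mathcal U}.$$ *)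

theory Defs
  imports "HOL-Analysis.Analysis"
begin

text \<open>
  The complexification \<open>H + \<i>H\<close> of a real inner product space \<open>H\<close>: the pair \<open>(x, y)\<close> stands for
  \<open>x + \<i>y\<close>. Addition, real scaling and the topology are those of the product type, whose norm is the
  one induced by the complex inner product (see \<open>norm_power2_eq_cplx_inner\<close> below).
\<close>

type_synonym 'h cplx = "'h \<times> 'h"

definition cplx_scale :: "complex \<Rightarrow> 'h::real_vector cplx \<Rightarrow> 'h cplx" where
  "cplx_scale c z = (Re c *\<^sub>R fst z - Im c *\<^sub>R snd z, Re c *\<^sub>R snd z + Im c *\<^sub>R fst z)"

definition cplx_cnj :: "'h::real_vector cplx \<Rightarrow> 'h cplx" where
  "cplx_cnj z = (fst z, - snd z)"

definition cplx_inner :: "'h::real_inner cplx \<Rightarrow> 'h cplx \<Rightarrow> complex" where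
  "cplx_inner z w =
     Complex (fst z \<bullet> fst w + snd z \<bullet> snd w) (snd z \<bullet> fst w - fst z \<bullet> snd w)"

lemma cplx_scale_of_real: "cplx_scale (complex_of_real t) z = t *\<^sub>R z"
  by (simp add: cplx_scale_def prod_eq_iff)

lemma cplx_inner_scale_left: "cplx_inner (cplx_scale c z) w = c * cplx_inner z w"
  by (simp add: cplx_inner_def cplx_scale_def complex_eq_iff algebra_simps)

lemma cplx_inner_commute: "cplx_inner w z = cnj (cplx_inner z w)"
  by (simp add: cplx_inner_def complex_eq_iff inner_commute)

lemma norm_power2_eq_cplx_inner: "complex_of_real ((norm z)\<^sup>2) = cplx_inner z z"
  by (cases z) (simp add: cplx_inner_def complex_eq_iff power2_norm_eq_inner inner_commute)

definition complex_frechet_differentiable ::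
    "('h::real_inner cplx \<times> 'h cplx \<Rightarrow> complex) \<Rightarrow> 'h cplx \<times> 'h cplx \<Rightarrow> bool" where
  "complex_frechet_differentiable g w \<longleftrightarrow>
     (\<exists>D. (g has_derivative D) (at w) \<and>
          (\<forall>c a b. D (cplx_scale c a, cplx_scale c b) = c * D (a, b)))"

definition separate_analytic_extension ::
    "('h::real_inner cplx \<Rightarrow> complex) \<Rightarrow> ('h cplx \<times> 'h cplx \<Rightarrow> complex) \<Rightarrow> bool" where
  "separate_analytic_extension f g \<longleftrightarrow>
     continuous_on UNIV g \<and> (\<forall>w. complex_frechet_differentiable g w) \<and>
     (\<forall>z. g (z, cplx_cnj z) = f z)"

definition analytic_in_z_and_cnj :: "('h::real_inner cplx \<Rightarrow> complex) \<Rightarrow> bool" where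
  "analytic_in_z_and_cnj f \<longleftrightarrow> (\<exists>g. separate_analytic_extension f g)"

text \<open>
  \<open>p\<close> and \<open>q\<close> are the two components of the gradient at \<open>(z0, cplx_cnj z0)\<close> of an extension of \<open>f\<close>.
  They do not depend on the choice of the extension \<open>g\<close>: the derivative of \<open>f\<close> at \<open>z0\<close> determines
  \<open>D (a, cplx_cnj a)\<close> for all \<open>a\<close>, and these values determine the complex linear \<open>D\<close>.
\<close>

definition has_wirtinger_derivatives ::
    "('h::real_inner cplx \<Rightarrow> complex) \<Rightarrow> 'h cplx \<Rightarrow> 'h cplx \<Rightarrow> 'h cplx \<Rightarrow> bool" where
  "has_wirtinger_derivatives f z0 p q \<longleftrightarrow>
     (\<exists>g D. separate_analytic_extension f g \<and>
            (g has_derivative D) (at (z0, cplx_cnj z0)) \<and>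
            (\<forall>a b. D (a, b) = cplx_inner a (cplx_cnj p) + cplx_inner b (cplx_cnj q)))"

definition wirtinger_deriv :: "('h::real_inner cplx \<Rightarrow> complex) \<Rightarrow> 'h cplx \<Rightarrow> 'h cplx" where
  "wirtinger_deriv f z0 = (THE p. \<exists>q. has_wirtinger_derivatives f z0 p q)"

definition wirtinger_deriv_cnj :: "('h::real_inner cplx \<Rightarrow> complex) \<Rightarrow> 'h cplx \<Rightarrow> 'h cplx" where
  "wirtinger_deriv_cnj f z0 = (THE q. \<exists>p. has_wirtinger_derivatives f z0 p q)"

definition real_difference_quotient ::
    "('h::real_inner cplx \<Rightarrow> real) \<Rightarrow> 'h cplx \<Rightarrow> 'h cplx \<Rightarrow> real \<Rightarrow> real" where
  "real_difference_quotient f z0 dz t = (f (z0 + t *\<^sub>R dz) - f z0) / t"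

definition real_directional_derivative ::
    "('h::real_inner cplx \<Rightarrow> real) \<Rightarrow> 'h cplx \<Rightarrow> 'h cplx \<Rightarrow> real" where
  "real_directional_derivative f z0 dz = Lim (at 0) (real_difference_quotient f z0 dz)"

end

theory Submission
  imports Defs
begin

text \<open>
  Along the real line \<open>z0 + t dz\<close> the second argument of an extension \<open>g\<close> is
  \<open>cplx_cnj z0 + t cplx_cnj dz\<close>, so the chain rule gives the real directional derivative
  \<open>D (dz, cplx_cnj dz) = X + Y\<close>, where \<open>X = cplx_inner dz (cplx_cnj p)\<close> is complex linear in \<open>dz\<close>,
  \<open>Y = cplx_inner q dz\<close> is conjugate linear, and \<open>p\<close>, \<open>q\<close> are the two gradient components. As \<open>f\<close> is
  real valued, \<open>X + Y\<close> is real. Replacing \<open>dz\<close> by \<open>\<i> dz\<close> turns this into the statement that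
  \<open>\<i> (X - Y)\<close> is real, too. Hence \<open>X\<close> and \<open>Y\<close> are complex conjugates of each other, and
  \<open>X + Y = 2 Re Y\<close> (lemma \<open>difference_quotient_tendsto\<close>).

  Two further points are needed to pass from a gradient to the Wirtinger derivative. The gradient
  exists by the Riesz representation theorem (lemma \<open>riesz_representation\<close>), which is where
  completeness of the space enters: it is applied to the real parts of the two partial maps of
  \<open>D\<close>, and complex linearity recovers the imaginary parts. The gradient component \<open>q\<close> is unique because the formula just derived
  determines the real inner product of \<open>q\<close> with every vector from \<open>f\<close> alone (lemma
  \<open>wirtinger_deriv_cnj_eq\<close>).
\<close>

section \<open>Riesz representation on real Hilbert spaces\<close>

text \<open>
  The representing vector is the minimizer of \<open>\<phi> x = x \<bullet> x - 2 * F x\<close>, which is bounded below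
  because \<open>F\<close> is bounded. The parallelogram law makes every minimizing sequence Cauchy, and the
  first-order condition at the minimum reads \<open>F a = a \<bullet> v\<close>.
\<close>

lemma riesz_representation:
  fixes F :: "'a::{real_inner, complete_space} \<Rightarrow> real"
  assumes "bounded_linear F"
  obtains v where "\<And>a. F a = a \<bullet> v"
proof -
  interpret F: bounded_linear F by fact
  define \<phi> where "\<phi> x = x \<bullet> x - 2 * F x" for x
  obtain K where K: "\<And>x. norm (F x) \<le> norm x * K"
    using F.bounded by blast
  have lower: "- K\<^sup>2 \<le> \<phi> x" for x
  proof -
    have "F x \<le> norm x * K" using K[of x] by simp
    moreover have "0 \<le> (norm x - K)\<^sup>2" by simp
    ultimately show ?thesis
      unfolding \<phi>_def power2_norm_eq_inner[symmetric] by (simp add: power2_diff)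
  qed
  define m where "m = Inf (range \<phi>)"
  have bdd: "bdd_below (range \<phi>)"
    using lower by (auto intro!: bdd_belowI[of _ "- K\<^sup>2"])
  have m_le: "m \<le> \<phi> x" for x
    unfolding m_def by (rule cInf_lower) (use bdd in auto)
  have "\<exists>x. \<phi> x < m + 1 / real (Suc n)" for n
  proof -
    have "Inf (range \<phi>) < m + 1 / real (Suc n)" by (simp add: m_def)
    then show ?thesis using bdd by (subst (asm) cInf_less_iff) auto
  qed
  then obtain x where x: "\<And>n. \<phi> (x n) < m + 1 / real (Suc n)" by metis
  have parallelogram: "(norm (y - z))\<^sup>2 \<le> 2 * (\<phi> y - m) + 2 * (\<phi> z - m)" for y z
  proof -
    have "\<phi> ((1/2) *\<^sub>R (y + z)) = (\<phi> y + \<phi> z) / 2 - (norm (y - z))\<^sup>2 / 4"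
      unfolding \<phi>_def power2_norm_eq_inner F.scaleR F.add
      by (simp add: inner_add_left inner_add_right inner_diff_left inner_diff_right
          inner_commute field_simps)
    then show ?thesis using m_le[of "(1/2) *\<^sub>R (y + z)"] by (simp add: field_simps)
  qed
  have "Cauchy x"
  proof (rule metric_CauchyI)
    fix e :: real assume "0 < e"
    then obtain N where N: "1 / real (Suc N) < e\<^sup>2 / 4"
      using nat_approx_posE[of "e\<^sup>2 / 4"] by (metis divide_pos_pos zero_less_numeral zero_less_power)
    have small: "4 * (\<phi> (x n) - m) < e\<^sup>2" if "N \<le> n" for n
    proof -
      have "1 / real (Suc n) \<le> 1 / real (Suc N)" using that by (simp add: frac_le)
      then have "\<phi> (x n) - m < e\<^sup>2 / 4" using x[of n] N by linarith
      then show ?thesis by simp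
    qed
    have "dist (x i) (x j) < e" if "N \<le> i" "N \<le> j" for i j
    proof -
      have "(norm (x i - x j))\<^sup>2 < e\<^sup>2"
        using parallelogram[of "x i" "x j"] small[OF that(1)] small[OF that(2)] by linarith
      then show ?thesis
        using \<open>0 < e\<close> by (auto simp: dist_norm intro: power_less_imp_less_base)
    qed
    then show "\<exists>N. \<forall>i\<ge>N. \<forall>j\<ge>N. dist (x i) (x j) < e" by blast
  qed
  then obtain v where v: "x \<longlonglongrightarrow> v"
    using Cauchy_convergent convergent_def by blast
  have "(\<lambda>n. \<phi> (x n)) \<longlonglongrightarrow> \<phi> v"
    unfolding \<phi>_def by (intro tendsto_intros v F.tendsto)
  moreover have "(\<lambda>n. m + 1 / real (Suc n)) \<longlonglongrightarrow> m + 0"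
    by (intro tendsto_intros LIMSEQ_Suc[OF lim_1_over_n])
  ultimately have "\<phi> v \<le> m + 0"
    by (rule LIMSEQ_le) (use x less_imp_le in blast)
  then have min: "\<phi> v \<le> \<phi> y" for y
    using m_le[of y] by simp
  have "F a = a \<bullet> v" for a
  proof -
    define c where "c = a \<bullet> v - F a"
    define s where "s = 1 + a \<bullet> a"
    have s: "0 < s" unfolding s_def by (simp add: add_pos_nonneg)
    have "\<phi> (v + t *\<^sub>R a) = \<phi> v + 2 * t * c + t\<^sup>2 * (s - 1)" for t
      unfolding \<phi>_def c_def s_def F.add F.scaleR
      by (simp add: inner_add_left inner_add_right inner_commute algebra_simps power2_eq_square)
    then have "0 \<le> 2 * t * c + t\<^sup>2 * (s - 1)" for t
      using min[of "v + t *\<^sub>R a"] by simp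
    \<comment> \<open>The step \<open>- c / s\<close> makes the right-hand side negative, unless \<open>c = 0\<close>.\<close>
    from this[of "- c / s"] have "0 \<le> (2 * (- c / s) * c + (- c / s)\<^sup>2 * (s - 1)) * s\<^sup>2"
      by (simp only: zero_le_mult_iff zero_le_power2) simp
    also have "\<dots> = - (c\<^sup>2 * (s + 1))"
      using s by (simp add: field_simps power2_eq_square)
    finally have "c\<^sup>2 * (s + 1) \<le> 0" by simp
    then have "c = 0" using s by (auto simp: mult_le_0_iff)
    then show ?thesis by (simp add: c_def)
  qed
  then show thesis by (rule that)
qed

section \<open>Complex linear functionals on the complexification\<close>

lemma inner_eq_Re_cplx_inner: "z \<bullet> w = Re (cplx_inner z w)"
  by (simp add: cplx_inner_def inner_prod_def)

lemma cplx_inner_cnj_cnj: "cplx_inner (cplx_cnj z) (cplx_cnj w) = cplx_inner w z"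
  by (simp add: cplx_inner_def cplx_cnj_def inner_commute)

lemma cplx_cnj_cnj: "cplx_cnj (cplx_cnj z) = z"
  by (simp add: cplx_cnj_def)

lemma cplx_cnj_add_scaleR: "cplx_cnj (z + t *\<^sub>R w) = cplx_cnj z + t *\<^sub>R cplx_cnj w"
  by (simp add: cplx_cnj_def)

text \<open>
  A complex linear functional is determined by its real part, since \<open>Im (L a) = - Re (L (\<i> a))\<close>;
  representing the real part therefore represents the functional.
\<close>

lemma riesz_representation_cplx:
  fixes L :: "'h::{real_inner, complete_space} cplx \<Rightarrow> complex"
  assumes "bounded_linear L" and linear: "\<And>c a. L (cplx_scale c a) = c * L a"
  obtains v where "\<And>a. L a = cplx_inner a v"
proof -
  have "bounded_linear (\<lambda>a. Re (L a))"
    using bounded_linear_compose[OF bounded_linear_Re assms(1)] .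
  then obtain v where v: "\<And>a. Re (L a) = a \<bullet> v"
    using riesz_representation by blast
  have "L a = cplx_inner a v" for a
    using v[of a] v[of "cplx_scale \<i> a"]
    by (simp add: inner_eq_Re_cplx_inner linear cplx_inner_scale_left complex_eq_iff)
  then show thesis by (rule that)
qed

section \<open>Wirtinger derivatives\<close>

lemma has_wirtinger_derivatives_exists:
  fixes f :: "'h::{real_inner, complete_space} cplx \<Rightarrow> complex"
  assumes "analytic_in_z_and_cnj f"
  obtains p q where "has_wirtinger_derivatives f z0 p q"
proof -
  obtain g where g: "separate_analytic_extension f g"
    using assms unfolding analytic_in_z_and_cnj_def by blast
  then obtain D where D: "(g has_derivative D) (at (z0, cplx_cnj z0))"
    and linear: "\<And>c a b. D (cplx_scale c a, cplx_scale c b) = c * D (a, b)"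
    unfolding separate_analytic_extension_def complex_frechet_differentiable_def by blast
  interpret D: bounded_linear D using D by (rule has_derivative_bounded_linear)
  have scale_0: "cplx_scale c 0 = 0" for c
    by (simp add: cplx_scale_def zero_prod_def)
  have "bounded_linear (\<lambda>a. D (a, 0))"
    by (intro bounded_linear_compose[OF D.bounded_linear_axioms] bounded_linear_Pair
        bounded_linear_ident bounded_linear_zero)
  then obtain v where v: "\<And>a. D (a, 0) = cplx_inner a v"
    by (rule riesz_representation_cplx) (use linear[of _ _ 0] in \<open>auto simp: scale_0\<close>)
  have "bounded_linear (\<lambda>b. D (0, b))"
    by (intro bounded_linear_compose[OF D.bounded_linear_axioms] bounded_linear_Pair
        bounded_linear_ident bounded_linear_zero)
  then obtain w where w: "\<And>b. D (0, b) = cplx_inner b w"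
    by (rule riesz_representation_cplx) (use linear[of _ 0] in \<open>auto simp: scale_0\<close>)
  have "D (a, b) = cplx_inner a v + cplx_inner b w" for a b
    using D.add[of "(a, 0)" "(0, b)"] by (simp add: v w)
  then have "has_wirtinger_derivatives f z0 (cplx_cnj v) (cplx_cnj w)"
    unfolding has_wirtinger_derivatives_def using g D by (auto simp: cplx_cnj_cnj)
  then show thesis by (rule that)
qed

text \<open>
  The chain rule along \<open>t \<mapsto> (z0 + t a, cplx_cnj z0 + t cplx_cnj a)\<close> yields the derivative
  \<open>L a\<close>. Since \<open>f\<close> is real valued, \<open>L a\<close> is real for every \<open>a\<close>; the direction \<open>a = \<i> dz\<close> shows
  that the two gradient components contribute equal real parts in the direction \<open>dz\<close>.
\<close>

lemma difference_quotient_tendsto: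
  fixes f :: "'h::real_inner cplx \<Rightarrow> real"
  assumes "has_wirtinger_derivatives (\<lambda>z. complex_of_real (f z)) z0 p q"
  shows "(real_difference_quotient f z0 dz \<longlongrightarrow> 2 * Re (cplx_inner q dz)) (at 0)"
proof -
  obtain g D where g: "\<And>z. g (z, cplx_cnj z) = complex_of_real (f z)"
    and D: "(g has_derivative D) (at (z0, cplx_cnj z0))"
    and grad: "\<And>a b. D (a, b) = cplx_inner a (cplx_cnj p) + cplx_inner b (cplx_cnj q)"
    using assms unfolding has_wirtinger_derivatives_def separate_analytic_extension_def by blast
  interpret D: bounded_linear D using D by (rule has_derivative_bounded_linear)
  define L where "L a = cplx_inner a (cplx_cnj p) + cplx_inner q a" for a
  have deriv: "((\<lambda>t. complex_of_real (f (z0 + t *\<^sub>R a))) has_vector_derivative L a) (at 0)" for a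
  proof -
    have "((\<lambda>t::real. (z0 + t *\<^sub>R a, cplx_cnj z0 + t *\<^sub>R cplx_cnj a)) has_derivative
        (\<lambda>t. (t *\<^sub>R a, t *\<^sub>R cplx_cnj a))) (at 0)"
      by (auto intro!: derivative_eq_intros)
    then have "((\<lambda>t::real. g (z0 + t *\<^sub>R a, cplx_cnj z0 + t *\<^sub>R cplx_cnj a)) has_derivative
        (\<lambda>t. D (t *\<^sub>R a, t *\<^sub>R cplx_cnj a))) (at 0)"
      by (rule has_derivative_compose) (simp add: D)
    moreover have "D (t *\<^sub>R a, t *\<^sub>R cplx_cnj a) = t *\<^sub>R L a" for t
      using D.scaleR[of t "(a, cplx_cnj a)"] by (simp add: grad cplx_inner_cnj_cnj L_def)
    ultimately show ?thesis
      by (simp add: has_vector_derivative_def g cplx_cnj_add_scaleR[symmetric])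
  qed
  \<comment> \<open>The imaginary part of the curve \<open>t \<mapsto> of_real (f (z0 + t a))\<close> is constantly \<open>0\<close>.\<close>
  have real: "Im (L a) = 0" for a
    using bounded_linear.has_vector_derivative[OF bounded_linear_Im deriv[of a]]
    by (simp add: has_real_derivative_iff_has_vector_derivative[symmetric]
        DERIV_unique[OF _ DERIV_const])
  define X where "X = cplx_inner dz (cplx_cnj p)"
  define Y where "Y = cplx_inner q dz"
  \<comment> \<open>\<open>X\<close> is linear and \<open>Y\<close> conjugate linear in \<open>dz\<close>, so \<open>\<i> dz\<close> reverses their relative sign.\<close>
  have "cplx_inner q (cplx_scale \<i> dz) = - \<i> * Y"
    unfolding Y_def cplx_inner_commute[of q] by (simp add: cplx_inner_scale_left)
  then have "Im (\<i> * X - \<i> * Y) = 0"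
    using real[of "cplx_scale \<i> dz"] by (simp add: L_def X_def cplx_inner_scale_left)
  then have "Re (L dz) = 2 * Re Y" by (simp add: L_def X_def Y_def)
  moreover have "((\<lambda>t. f (z0 + t *\<^sub>R dz)) has_real_derivative Re (L dz)) (at 0)"
    using bounded_linear.has_vector_derivative[OF bounded_linear_Re deriv[of dz]]
    by (simp add: has_real_derivative_iff_has_vector_derivative)
  ultimately show ?thesis
    by (simp add: DERIV_def real_difference_quotient_def[abs_def] Y_def)
qed

text \<open>
  The limit of the difference quotients depends on \<open>f\<close> only, and it equals \<open>2 * (q \<bullet> dz)\<close> for
  every \<open>dz\<close>; two vectors with the same inner products coincide. This makes the definite
  description in \<^const>\<open>wirtinger_deriv_cnj\<close> meaningful.
\<close>

lemma wirtinger_deriv_cnj_eq: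
  fixes f :: "'h::real_inner cplx \<Rightarrow> real"
  assumes "has_wirtinger_derivatives (\<lambda>z. complex_of_real (f z)) z0 p q"
  shows "wirtinger_deriv_cnj (\<lambda>z. complex_of_real (f z)) z0 = q"
  unfolding wirtinger_deriv_cnj_def
proof (rule the_equality)
  show "\<exists>p. has_wirtinger_derivatives (\<lambda>z. complex_of_real (f z)) z0 p q"
    using assms by blast
next
  fix q' assume "\<exists>p'. has_wirtinger_derivatives (\<lambda>z. complex_of_real (f z)) z0 p' q'"
  then obtain p' where q': "has_wirtinger_derivatives (\<lambda>z. complex_of_real (f z)) z0 p' q'" by blast
  have "q' \<bullet> a = q \<bullet> a" for a
    using tendsto_unique[OF _ difference_quotient_tendsto[OF q', of a]
        difference_quotient_tendsto[OF assms, of a]]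
    by (simp add: inner_eq_Re_cplx_inner)
  then show "q' = q" using vector_eq_rdot by blast
qed

theorem theorem3p3:
  fixes f :: "'h::{real_inner, complete_space} cplx \<Rightarrow> real"
  assumes "continuous_on UNIV f"
    and "analytic_in_z_and_cnj (\<lambda>z. complex_of_real (f z))"
  shows "\<forall>z0 dz.
           (\<exists>L. (real_difference_quotient f z0 dz \<longlongrightarrow> L) (at 0)) \<and>
           real_directional_derivative f z0 dz =
             2 * Re (cplx_inner (wirtinger_deriv_cnj (\<lambda>z. complex_of_real (f z)) z0) dz)"
proof (intro allI)
  fix z0 dz :: "'h cplx"
  obtain p q where pq: "has_wirtinger_derivatives (\<lambda>z. complex_of_real (f z)) z0 p q"
    using has_wirtinger_derivatives_exists[OF assms(2)] by blast
  have "(real_difference_quotient f z0 dz \<longlongrightarrow> 2 * Re (cplx_inner q dz)) (at 0)"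
    using pq by (rule difference_quotient_tendsto)
  then show "(\<exists>L. (real_difference_quotient f z0 dz \<longlongrightarrow> L) (at 0)) \<and>
      real_directional_derivative f z0 dz =
        2 * Re (cplx_inner (wirtinger_deriv_cnj (\<lambda>z. complex_of_real (f z)) z0) dz)"
    unfolding real_directional_derivative_def wirtinger_deriv_cnj_eq[OF pq]
    by (auto intro: tendsto_Lim)
qed

end
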